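(* Let $T\in\mathbb{N}$ and let $\mathcal{A}=\{O_1,\dots,O_k\}$ be a finite action set of traceless observables on $\mathbb{C}^d$ such that there exist two distinct $O_a,O_b\in\mathcal{A}$ with eigenvectors $|\psi_A\rangle,|\psi_B\rangle$ for their respective largest eigenvalues satisfying, for all $i\ne a$ and $j\ne b$, $$\langle\psi_A|O_a|\psi_A\rangle>\langle\psi_A|O_i|\psi_A\rangle\quad\text{and}\quad\langle\psi_B|O_b|\psi_B\rangle>\langle\psi_B|O_j|\psi_B\rangle.$$ Then for any policy $\pi$ there exists an environment $\rho\in\mathcal{S}_d$ such that $$\mathbb{E}_{\rho,\pi}\big[R_T(\mathcal{A},\rho,\pi)\big]\ge C_{\mathcal{A}}\sqrt T,$$ where $C_{\mathcal{A}}>0$ is a constant that depends only on the action set.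
   Context: $\mathcal{S}_d$ is the set of density matrices on $\mathbb{C}^d$; observables are Hermitian $d\times d$ matrices. Discrete multi-armed quantum bandit: in each round $t=1,\dots,T$ the learner receives a copy of the unknown state $\rho$, chooses $A_t\in[k]$ according to a policy $\pi=(\pi_t)$, where $\pi_t(\cdot\mid a_1,x_1,\dots,a_{t-1},x_{t-1})$ is a probability distribution on $[k]$, and measures $\rho$ in the eigenbasis of $O_{A_t}=\sum_i\lambda_{A_t,i}\Pi_{A_t,i}$ (spectral decomposition), receiving reward $X_t=\lambda_{A_t,i}$ with probability $\mathrm{Tr}(\rho\Pi_{A_t,i})$. The regret is $R_T(\mathcal{A},\rho,\pi)=\sum_{t=1}^T\big(\max_{O\in\mathcal{A}}\mathrm{Tr}(\rho O)-\mathrm{Tr}(\rho O_{A_t})\big)$ and $\mathbb{E}_{\rho,\pi}$ is the expectation over the induced process. *)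

theory Defs
  imports "Jordan_Normal_Form.Schur_Decomposition" "HOL-Probability.Probability_Mass_Function"
begin

definition mtrace :: "complex mat \<Rightarrow> complex" where
  "mtrace A = (\<Sum>i<dim_row A. A $$ (i,i))"

definition hermitian :: "nat \<Rightarrow> complex mat \<Rightarrow> bool" where
  "hermitian d A \<longleftrightarrow> A \<in> carrier_mat d d \<and> mat_adjoint A = A"

definition density_op :: "nat \<Rightarrow> complex mat \<Rightarrow> bool" where
  "density_op d \<rho> \<longleftrightarrow> hermitian d \<rho> \<and>
     (\<forall>v\<in>carrier_vec d. 0 \<le> Re ((\<rho> *\<^sub>v v) \<bullet>c v)) \<and> mtrace \<rho> = 1"

definition qform :: "complex mat \<Rightarrow> complex Matrix.vec \<Rightarrow> real" where
  "qform Ob \<psi> = Re ((Ob *\<^sub>v \<psi>) \<bullet>c \<psi>)"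

definition top_eigvec :: "complex mat \<Rightarrow> complex Matrix.vec \<Rightarrow> bool" where
  "top_eigvec Ob \<psi> \<longleftrightarrow> \<psi> \<bullet>c \<psi> = 1 \<and>
     (\<exists>l::real. eigenvector Ob \<psi> (of_real l) \<and> (\<forall>\<mu>. eigenvalue Ob \<mu> \<longrightarrow> Re \<mu> \<le> l))"

definition eig_proj :: "nat \<Rightarrow> complex mat \<Rightarrow> real \<Rightarrow> complex mat" where
  "eig_proj d Ob l = (THE P. P \<in> carrier_mat d d \<and> P * P = P \<and> mat_adjoint P = P \<and>
      (\<forall>v\<in>carrier_vec d. P *\<^sub>v v = v \<longleftrightarrow> Ob *\<^sub>v v = of_real l \<cdot>\<^sub>v v))"

definition meas_pmf :: "nat \<Rightarrow> complex mat \<Rightarrow> complex mat \<Rightarrow> real pmf" where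
  "meas_pmf d \<rho> Ob = embed_pmf (\<lambda>x. if eigenvalue Ob (of_real x)
       then Re (mtrace (\<rho> * eig_proj d Ob x)) else 0)"

text \<open>A policy: pi t h is the distribution of the action in round t+1
  given the history h = [(a_1,x_1),...,(a_t,x_t)].\<close>
type_synonym policy = "nat \<Rightarrow> (nat \<times> real) list \<Rightarrow> nat pmf"

definition valid_policy :: "nat \<Rightarrow> policy \<Rightarrow> bool" where
  "valid_policy k \<pi> \<longleftrightarrow> (\<forall>t h. set_pmf (\<pi> t h) \<subseteq> {..<k})"

fun hist :: "nat \<Rightarrow> (nat \<Rightarrow> complex mat) \<Rightarrow> complex mat \<Rightarrow> policy \<Rightarrow> nat \<Rightarrow> (nat \<times> real) list pmf" where
  "hist d Ob \<rho> \<pi> 0 = return_pmf []"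
| "hist d Ob \<rho> \<pi> (Suc t) =
     bind_pmf (hist d Ob \<rho> \<pi> t) (\<lambda>h. bind_pmf (\<pi> t h) (\<lambda>a.
       map_pmf (\<lambda>x. h @ [(a, x)]) (meas_pmf d \<rho> (Ob a))))"

definition regret :: "nat \<Rightarrow> (nat \<Rightarrow> complex mat) \<Rightarrow> complex mat \<Rightarrow> (nat \<times> real) list \<Rightarrow> real" where
  "regret k Ob \<rho> h = (\<Sum>p\<leftarrow>h. Max ((\<lambda>i. Re (mtrace (\<rho> * Ob i))) ` {..<k}) - Re (mtrace (\<rho> * Ob (fst p))))"

definition expected_regret :: "nat \<Rightarrow> nat \<Rightarrow> (nat \<Rightarrow> complex mat) \<Rightarrow> complex mat \<Rightarrow> policy \<Rightarrow> nat \<Rightarrow> real" where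
  "expected_regret d k Ob \<rho> \<pi> T = measure_pmf.expectation (hist d Ob \<rho> \<pi> T) (regret k Ob \<rho>)"

end

(*
  Fix the states rho = (1 - Delta) I/d + Delta |psiA><psiA| and sigma, the same with psiB,
  where Delta = 1 / (2 d sqrt T). As the observables are traceless, their mean rewards are
  Delta <psi|O|psi>, so under rho every pull of an arm other than a costs at least c Delta,
  and under sigma every pull of a costs at least c Delta, with c the least of the gaps.
  Both states have all diagonal entries at least (1 - Delta)/d in any orthonormal basis, so a
  single measurement yields outcome laws with Bhattacharyya coefficient at least
  1 - (d Delta)^2 / 2. This coefficient is supermultiplicative along the adaptive interaction,
  hence stays above 7/8 for T rounds; the two history laws cannot be told apart, and the policy
  pays a total of order T Delta, i.e. sqrt T, under one of the two states.
*)
theory Submission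
  imports Defs
begin

section \<open>Affinity of finitely supported distributions\<close>

text \<open>By the arithmetic-geometric mean inequality, the infimum over $g > 0$ of
  $(E_p\, g + E_q\, (1/g))/2$ is the Bhattacharyya coefficient $\sum_x \sqrt{p(x) q(x)}$. This
  variational form passes through mixtures and images without any reference to densities.\<close>
definition affinity_ge :: "real \<Rightarrow> 'a pmf \<Rightarrow> 'a pmf \<Rightarrow> bool" where
  "affinity_ge \<beta> p q \<longleftrightarrow> (\<forall>g. (\<forall>x. 0 < g x) \<longrightarrow>
     2 * \<beta> \<le> measure_pmf.expectation p g + measure_pmf.expectation q (\<lambda>x. 1 / g x))"

lemma affinity_geD:
  "affinity_ge \<beta> p q \<Longrightarrow> (\<And>x. 0 < g x) \<Longrightarrow>
     2 * \<beta> \<le> measure_pmf.expectation p g + measure_pmf.expectation q (\<lambda>x. 1 / g x)"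
  by (auto simp: affinity_ge_def)

lemma affinity_ge_map:
  "affinity_ge \<beta> p q \<Longrightarrow> affinity_ge \<beta> (map_pmf f p) (map_pmf f q)"
  by (auto simp: affinity_ge_def)

text \<open>Pointwise \<open>g x + 1 / g x\<close> is at least 2. Finite support matters: a
  non-integrable function has expectation 0 by default, so on an infinite support both expectations
  could collapse to 0.\<close>

lemma affinity_ge_refl:
  assumes "finite (set_pmf p)"
  shows "affinity_ge 1 p p"
  unfolding affinity_ge_def
proof safe
  fix g :: "'a \<Rightarrow> real" assume g: "\<forall>x. 0 < g x"
  have "2 * 1 = measure_pmf.expectation p (\<lambda>_. 2 :: real)" by simp
  also have "\<dots> \<le> measure_pmf.expectation p (\<lambda>x. g x + 1 / g x)"
  proof (intro integral_mono integrable_measure_pmf_finite assms)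
    fix x
    have "0 \<le> (g x - 1)\<^sup>2 / g x" using g by (simp add: less_imp_le)
    also have "\<dots> = g x + 1 / g x - 2"
      using g[rule_format, of x] by (simp add: field_simps power2_eq_square)
    finally show "2 \<le> g x + 1 / g x" by simp
  qed
  also have "\<dots> = measure_pmf.expectation p g + measure_pmf.expectation p (\<lambda>x. 1 / g x)"
    by (intro Bochner_Integration.integral_add integrable_measure_pmf_finite assms)
  finally show "2 * 1 \<le> measure_pmf.expectation p g + measure_pmf.expectation p (\<lambda>x. 1 / g x)" .
qed

section \<open>Mixtures of finitely supported distributions\<close>

lemma expectation_bind_finite:
  fixes h :: "'b \<Rightarrow> real"
  assumes "finite (set_pmf p)" "\<And>x. x \<in> set_pmf p \<Longrightarrow> finite (set_pmf (f x))"
  shows "measure_pmf.expectation (bind_pmf p f) h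
    = measure_pmf.expectation p (\<lambda>x. measure_pmf.expectation (f x) h)"
  by (subst pmf_expectation_bind[of "set_pmf p"])
     (use assms in \<open>auto simp: integral_measure_pmf[of "set_pmf p"]\<close>)

lemma expectation_mono_finite:
  fixes f g :: "'a \<Rightarrow> real"
  assumes "finite (set_pmf p)" "\<And>x. x \<in> set_pmf p \<Longrightarrow> f x \<le> g x"
  shows "measure_pmf.expectation p f \<le> measure_pmf.expectation p g"
  using assms by (intro integral_mono_AE integrable_measure_pmf_finite) (auto simp: AE_measure_pmf_iff)

lemma expectation_cong_finite:
  fixes f g :: "'a \<Rightarrow> real"
  assumes "\<And>x. x \<in> set_pmf p \<Longrightarrow> f x = g x"
  shows "measure_pmf.expectation p f = measure_pmf.expectation p g"
  using assms by (intro integral_cong_AE) (auto simp: AE_measure_pmf_iff)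

text \<open>The test function may be rescaled, which turns the bound on a sum into one on a product:
  for \<open>s * g\<close> with \<open>s = \<beta> / E\<close> the first expectation is exactly
  \<beta>, so the second must supply the other \<beta>.\<close>

lemma affinity_ge_product:
  assumes "affinity_ge \<beta> p q" "0 < \<beta>" and g: "\<And>x. 0 < g x"
    and G: "0 < measure_pmf.expectation p g"
  shows "\<beta>\<^sup>2 / measure_pmf.expectation p g \<le> measure_pmf.expectation q (\<lambda>x. 1 / g x)"
proof -
  define E F where "E = measure_pmf.expectation p g" "F = measure_pmf.expectation q (\<lambda>x. 1 / g x)"
  define s where "s = \<beta> / E"
  have s: "0 < s" using assms(2) G by (simp add: s_def E_F_def)
  have "2 * \<beta> \<le> measure_pmf.expectation p (\<lambda>x. s * g x) + measure_pmf.expectation q (\<lambda>x. 1 / (s * g x))"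
    using s g by (intro affinity_geD[OF assms(1)]) simp
  also have "(\<lambda>x. 1 / (s * g x)) = (\<lambda>x. (1 / s) * (1 / g x))" by simp
  also have "measure_pmf.expectation p (\<lambda>x. s * g x) + measure_pmf.expectation q \<dots> = s * E + F / s"
    by (simp only: integral_mult_right_zero E_F_def) simp
  also have "\<dots> = \<beta> + F * E / \<beta>"
    using G assms(2) by (simp add: s_def E_F_def)
  finally have "\<beta> \<le> F * E / \<beta>" by simp
  then have "\<beta>\<^sup>2 \<le> F * E" using assms(2) by (simp add: field_simps power2_eq_square)
  then show ?thesis using G unfolding E_F_def[symmetric] by (simp add: field_simps)
qed

lemma expectation_pos_finite:
  fixes g :: "'a \<Rightarrow> real"
  assumes "finite (set_pmf p)" "\<And>x. 0 < g x"
  shows "0 < measure_pmf.expectation p g"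
proof -
  have "0 < (\<Sum>x\<in>set_pmf p. pmf p x *\<^sub>R g x)"
    using assms set_pmf_not_empty[of p] by (intro sum_pos) (auto simp: pmf_positive)
  also have "\<dots> = measure_pmf.expectation p g"
    using assms by (subst integral_measure_pmf[of "set_pmf p"]) auto
  finally show ?thesis .
qed

text \<open>Supermultiplicativity along a two-stage experiment. The product form, applied to the
  second stage at each \<open>x\<close>, bounds the conditional expectation of \<open>1 / h\<close>
  below by \<open>\<beta>\<^sup>2 / G x\<close>, where \<open>G x\<close> is that of
  \<open>h\<close>; a multiple of \<open>G\<close> then serves as test function for the first
  stage.\<close>

lemma affinity_ge_bind:
  assumes pq: "affinity_ge \<alpha> p q" and fin: "finite (set_pmf p)" "finite (set_pmf q)"
    and \<beta>: "0 < \<beta>"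
    and fg: "\<And>x. x \<in> set_pmf p \<union> set_pmf q \<Longrightarrow>
      finite (set_pmf (f x)) \<and> finite (set_pmf (g x)) \<and> affinity_ge \<beta> (f x) (g x)"
  shows "affinity_ge (\<alpha> * \<beta>) (bind_pmf p f) (bind_pmf q g)"
  unfolding affinity_ge_def
proof safe
  fix h :: "'b \<Rightarrow> real" assume h: "\<forall>y. 0 < h y"
  \<comment> \<open>Test functions must be positive everywhere, also outside the two supports, where
    nothing is known about \<open>f x\<close>; hence the default value 1.\<close>
  define G where "G x = (let e = measure_pmf.expectation (f x) h in if 0 < e then e else 1)" for x
  have G: "0 < G x" for x by (simp add: G_def Let_def)
  have Gp: "measure_pmf.expectation (f x) h = G x" if "x \<in> set_pmf p \<union> set_pmf q" for x
    using expectation_pos_finite[of "f x" h] h fg[OF that] by (simp add: G_def Let_def)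
  \<comment> \<open>With the scaling \<open>1 / \<beta>\<close> both terms carry the same factor:
    the reciprocal \<open>\<beta> / G x\<close> equals
    \<open>(1 / \<beta>) * (\<beta>\<^sup>2 / G x)\<close>.\<close>
  have "2 * \<alpha> \<le> measure_pmf.expectation p (\<lambda>x. (1 / \<beta>) * G x) + measure_pmf.expectation q (\<lambda>x. 1 / ((1 / \<beta>) * G x))"
    using G \<beta> by (intro affinity_geD[OF pq]) simp
  also have "(\<lambda>x. 1 / ((1 / \<beta>) * G x)) = (\<lambda>x. (1 / \<beta>) * (\<beta>\<^sup>2 / G x))"
    using \<beta> by (auto simp: power2_eq_square)
  finally have "2 * \<alpha> \<le> (1 / \<beta>) * (measure_pmf.expectation p G + measure_pmf.expectation q (\<lambda>x. \<beta>\<^sup>2 / G x))"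
    by (simp only: integral_mult_right_zero distrib_left)
  then have "2 * (\<alpha> * \<beta>) \<le> measure_pmf.expectation p G + measure_pmf.expectation q (\<lambda>x. \<beta>\<^sup>2 / G x)"
    using \<beta> by (simp add: field_simps)
  also have "measure_pmf.expectation p G = measure_pmf.expectation (bind_pmf p f) h"
    using fin fg by (subst expectation_bind_finite) (auto intro!: expectation_cong_finite simp: Gp)
  also have "measure_pmf.expectation q (\<lambda>x. \<beta>\<^sup>2 / G x)
      \<le> measure_pmf.expectation q (\<lambda>x. measure_pmf.expectation (g x) (\<lambda>y. 1 / h y))"
  proof (intro expectation_mono_finite fin)
    fix x assume x: "x \<in> set_pmf q"
    show "\<beta>\<^sup>2 / G x \<le> measure_pmf.expectation (g x) (\<lambda>y. 1 / h y)"
      using affinity_ge_product[of \<beta> "f x" "g x" h] fg[of x] \<beta> h x Gp[of x] G[of x] by simp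
  qed
  also have "\<dots> = measure_pmf.expectation (bind_pmf q g) (\<lambda>y. 1 / h y)"
    using fin fg by (subst expectation_bind_finite) auto
  finally show "2 * (\<alpha> * \<beta>) \<le> measure_pmf.expectation (bind_pmf p f) h
      + measure_pmf.expectation (bind_pmf q g) (\<lambda>y. 1 / h y)" by simp
qed

text \<open>The testing step: \<open>u\<close> is a randomized test between \<open>p\<close> and
  \<open>q\<close>, and the right-hand side is the sum of its two error probabilities. High affinity
  keeps this sum away from 0.\<close>

lemma affinity_two_point:
  fixes u :: "'a \<Rightarrow> real"
  assumes "affinity_ge \<beta> p q" "finite (set_pmf p)" "finite (set_pmf q)"
    and u: "\<And>x. 0 \<le> u x" "\<And>x. u x \<le> 1"
  shows "(\<beta> - 1/4) / 2 \<le> measure_pmf.expectation p u + measure_pmf.expectation q (\<lambda>x. 1 - u x)"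
proof -
  \<comment> \<open>\<open>g\<close> runs from \<open>1/4\<close> to \<open>4\<close>, so by convexity \<open>1/g\<close> lies below the chord from \<open>4\<close> to \<open>1/4\<close>.\<close>
  define g where "g x = 1/4 + 15/4 * u x" for x
  have g: "0 < g x" for x using u(1)[of x] by (simp add: g_def)
  have int: "integrable p f" "integrable q f" for f :: "'a \<Rightarrow> real"
    using assms by (auto intro: integrable_measure_pmf_finite)
  have "1 / g x \<le> 1/4 + 4 * (1 - u x)" for x
  proof -
    have "0 \<le> u x * (1 - u x)" using u by simp
    \<comment> \<open>The chord has slope 15/4 in \<open>1 - u x\<close>. Rounding it up to 4 puts
      the factor 4 in front of both errors, and the excess of this product over 1 is visibly
      nonnegative.\<close>
    moreover have "(1/4 + 4 * (1 - u x)) * g x = 1 + (1 - u x) / 16 + 15 * (u x * (1 - u x))"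
      unfolding g_def by (simp add: field_simps)
    ultimately have "1 \<le> (1/4 + 4 * (1 - u x)) * g x" using u(2)[of x] by simp
    then show ?thesis using g[of x] by (simp add: field_simps)
  qed
  then have "measure_pmf.expectation q (\<lambda>x. 1 / g x)
      \<le> measure_pmf.expectation q (\<lambda>x. 1/4 + 4 * (1 - u x))"
    by (intro integral_mono int)
  also have "\<dots> = 1/4 + 4 * measure_pmf.expectation q (\<lambda>x. 1 - u x)"
    by (subst Bochner_Integration.integral_add[OF int(2) int(2)]) (simp only: integral_mult_right_zero, simp)
  finally have 1: "measure_pmf.expectation q (\<lambda>x. 1 / g x)
      \<le> 1/4 + 4 * measure_pmf.expectation q (\<lambda>x. 1 - u x)" .
  have "measure_pmf.expectation p g = 1/4 + 15/4 * measure_pmf.expectation p u"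
    unfolding g_def by (subst Bochner_Integration.integral_add) (auto intro: int)
  moreover have "0 \<le> measure_pmf.expectation p u"
    using u by (intro integral_nonneg_AE) auto
  ultimately show ?thesis using affinity_geD[OF assms(1), of g] g 1 by auto
qed

text \<open>The floor leaves only mass \<Delta> to distribute freely, so two corresponding masses
  \<open>x\<close>, \<open>y\<close> differ by at most \<Delta>, while \<open>x + y\<close> is at
  least \<open>1 / d\<close>. Each index therefore loses at most
  \<open>(x - y)\<^sup>2 / (x + y)\<close>, which is at most \<open>d * \<Delta>\<^sup>2\<close>,
  and there are \<open>d\<close> of them.\<close>

lemma affinity_ge_near_uniform:
  fixes r s :: "nat pmf"
  assumes d: "0 < d" and supp: "set_pmf r \<subseteq> {..<d}" "set_pmf s \<subseteq> {..<d}"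
    and \<Delta>: "\<Delta> \<le> 1/2"
    and lower: "\<And>i. i < d \<Longrightarrow> (1 - \<Delta>) / real d \<le> pmf r i" "\<And>i. i < d \<Longrightarrow> (1 - \<Delta>) / real d \<le> pmf s i"
  shows "affinity_ge (1 - (real d * \<Delta>)\<^sup>2 / 2) r s"
  unfolding affinity_ge_def
proof safe
  fix g :: "nat \<Rightarrow> real" assume g: "\<forall>i. 0 < g i"
  have E: "measure_pmf.expectation r f = (\<Sum>i<d. f i * pmf r i)"
       "measure_pmf.expectation s f = (\<Sum>i<d. f i * pmf s i)" for f :: "nat \<Rightarrow> real"
    using supp by (auto intro!: integral_measure_pmf_real)
  have one: "(\<Sum>i<d. pmf r i) = 1" "(\<Sum>i<d. pmf s i) = 1"
    using E(1)[of "\<lambda>_. 1"] E(2)[of "\<lambda>_. 1"] by simp_all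
  \<comment> \<open>The excesses over the floor are nonnegative and add up to \<Delta>, so none
    exceeds \<Delta>.\<close>
  have upper: "p i \<le> (1 - \<Delta>) / real d + \<Delta>"
    if p: "\<And>i. i < d \<Longrightarrow> (1 - \<Delta>) / real d \<le> p i" "(\<Sum>i<d. p i) = 1" and i: "i < d"
    for p :: "nat \<Rightarrow> real" and i
  proof -
    have "p i - (1 - \<Delta>) / real d \<le> (\<Sum>i<d. p i - (1 - \<Delta>) / real d)"
      using p(1) i by (intro member_le_sum) auto
    also have "\<dots> = \<Delta>" using p(2) d by (simp add: sum_subtractf)
    finally show ?thesis by simp
  qed
  have pointwise: "pmf r i + pmf s i - real d * \<Delta>\<^sup>2 \<le> g i * pmf r i + 1 / g i * pmf s i"
    if i: "i < d" for i
  proof -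
    define x y z where "x = pmf r i" "y = pmf s i" "z = g i"
    have xy: "0 \<le> x" "0 \<le> y" "1 / real d \<le> x + y" "\<bar>x - y\<bar> \<le> \<Delta>" "0 < z"
    proof -
      show "0 < z" "0 \<le> x" "0 \<le> y" using g by (auto simp: x_y_z_def)
      show "\<bar>x - y\<bar> \<le> \<Delta>"
        using lower[OF i] upper[OF lower(1) one(1) i] upper[OF lower(2) one(2) i]
        unfolding x_y_z_def by linarith
      have "(1 / 2) / real d \<le> (1 - \<Delta>) / real d" using \<Delta> d by (intro divide_right_mono) auto
      then show "1 / real d \<le> x + y" using lower[OF i] unfolding x_y_z_def by simp
    qed
    have "0 < 1 / real d" using d by simp
    then have pos: "0 < x + y" using xy by linarith
    have "(x - y)\<^sup>2 \<le> \<Delta>\<^sup>2" using xy(4) abs_le_square_iff[of "x - y" \<Delta>] by force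
    also have "\<dots> \<le> \<Delta>\<^sup>2 * (real d * (x + y))"
    proof -
      have "1 \<le> real d * (x + y)" using xy(3) d by (simp add: field_simps)
      then show ?thesis by (simp add: mult_le_cancel_left1)
    qed
    finally have 1: "(x - y)\<^sup>2 / (x + y) \<le> real d * \<Delta>\<^sup>2" using pos by (simp add: field_simps)
    \<comment> \<open>Since \<open>x + y - (x - y)\<^sup>2 / (x + y)\<close> is the harmonic mean
      term \<open>4 * x * y / (x + y)\<close>, this is its comparison with
      \<open>z * x + y / z\<close>, the difference being written as a sum of squares.\<close>
    have "0 \<le> ((x * z - y)\<^sup>2 + x * y * (z - 1)\<^sup>2) / (z * (x + y))"
      using xy pos by (intro divide_nonneg_pos) auto
    also have "\<dots> = z * x + 1 / z * y - (x + y) + (x - y)\<^sup>2 / (x + y)"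
      using xy(5) pos by (simp add: divide_simps power2_eq_square) (simp add: algebra_simps)
    finally show ?thesis using 1 unfolding x_y_z_def by linarith
  qed
  have "2 * (1 - (real d * \<Delta>)\<^sup>2 / 2) = (\<Sum>i<d. pmf r i + pmf s i - real d * \<Delta>\<^sup>2)"
    by (simp add: sum.distrib sum_subtractf one power2_eq_square)
  also have "\<dots> \<le> (\<Sum>i<d. g i * pmf r i + 1 / g i * pmf s i)"
    by (intro sum_mono) (use pointwise in auto)
  finally show "2 * (1 - (real d * \<Delta>)\<^sup>2 / 2)
      \<le> measure_pmf.expectation r g + measure_pmf.expectation s (\<lambda>x. 1 / g x)"
    by (simp only: E sum.distrib)
qed

section \<open>Spectral theorem for Hermitian matrices\<close>

lemma mat_adjoint_carrier [simp]: "A \<in> carrier_mat n m \<Longrightarrow> mat_adjoint A \<in> carrier_mat m n"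
  by (auto simp: mat_adjoint_def mat_of_rows_def)

lemma dim_mat_adjoint [simp]: "dim_row (mat_adjoint A) = dim_col A" "dim_col (mat_adjoint A) = dim_row A"
  by (auto simp: mat_adjoint_def mat_of_rows_def)

lemma index_mat_adjoint [simp]:
  "i < dim_col A \<Longrightarrow> j < dim_row A \<Longrightarrow> mat_adjoint A $$ (i, j) = conjugate (A $$ (j, i))"
  by (simp add: mat_adjoint_def mat_of_rows_def)

lemma mat_adjoint_adjoint [simp]: "mat_adjoint (mat_adjoint A) = A"
  by (rule eq_matI) auto

lemma mat_adjoint_mult:
  fixes A :: "'a :: conjugatable_field mat"
  assumes "A \<in> carrier_mat n m" "B \<in> carrier_mat m l"
  shows "mat_adjoint (A * B) = mat_adjoint B * mat_adjoint A"
proof (rule eq_matI)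
  fix i j assume ij: "i < dim_row (mat_adjoint B * mat_adjoint A)" "j < dim_col (mat_adjoint B * mat_adjoint A)"
  have "conjugate (Matrix.row A j \<bullet> col B i) = (\<Sum>k<m. conjugate (A $$ (j,k)) * conjugate (B $$ (k,i)))"
    using assms ij
    by (simp add: scalar_prod_def sum_conjugate conjugate_dist_mul atLeast0LessThan)
  also have "\<dots> = Matrix.row (mat_adjoint B) i \<bullet> col (mat_adjoint A) j"
    using assms ij by (simp add: scalar_prod_def atLeast0LessThan mult.commute)
  finally show "mat_adjoint (A * B) $$ (i, j) = (mat_adjoint B * mat_adjoint A) $$ (i, j)"
    using assms ij by simp
qed (use assms in auto)

lemma mat_adjoint_one [simp]: "mat_adjoint (1\<^sub>m n :: complex mat) = 1\<^sub>m n"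
  by (rule eq_matI) auto

lemma mat_adjoint_four_block:
  assumes "A \<in> carrier_mat n1 m1" "B \<in> carrier_mat n1 m2" "C \<in> carrier_mat n2 m1" "D \<in> carrier_mat n2 m2"
  shows "mat_adjoint (four_block_mat A B C D)
    = four_block_mat (mat_adjoint A) (mat_adjoint C) (mat_adjoint B) (mat_adjoint D)"
  by (rule eq_matI) (use assms in auto)

lemma mult_block_diag_mat:
  assumes "A \<in> carrier_mat n n" "B \<in> carrier_mat m m" "C \<in> carrier_mat n n" "D \<in> carrier_mat m m"
  shows "four_block_mat A (0\<^sub>m n m) (0\<^sub>m m n) B * four_block_mat C (0\<^sub>m n m) (0\<^sub>m m n) D
    = four_block_mat (A * C) (0\<^sub>m n m) (0\<^sub>m m n) (B * D :: 'a :: comm_ring_1 mat)"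
  by (subst mult_four_block_mat[of _ n n _ m _ m _ _ n _ m]) (use assms in auto)

definition unitary_mat :: "nat \<Rightarrow> complex mat \<Rightarrow> bool" where
  "unitary_mat n U \<longleftrightarrow> U \<in> carrier_mat n n \<and> mat_adjoint U * U = 1\<^sub>m n \<and> U * mat_adjoint U = 1\<^sub>m n"

lemma unitary_matI:
  assumes "U \<in> carrier_mat n n" "mat_adjoint U * U = 1\<^sub>m n"
  shows "unitary_mat n U"
  using assms mat_mult_left_right_inverse[of "mat_adjoint U" n U] by (auto simp: unitary_mat_def)

lemma unitary_mat_mult:
  assumes "unitary_mat n U" "unitary_mat n V"
  shows "unitary_mat n (U * V)"
proof (rule unitary_matI)
  have c: "U \<in> carrier_mat n n" "V \<in> carrier_mat n n" using assms by (auto simp: unitary_mat_def)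
  then show "U * V \<in> carrier_mat n n" by simp
  have "mat_adjoint U * (U * V) = V"
    using assms c by (simp add: unitary_mat_def flip: assoc_mult_mat[of _ n n _ n _ n])
  then show "mat_adjoint (U * V) * (U * V) = 1\<^sub>m n"
    using assms c by (simp add: unitary_mat_def mat_adjoint_mult assoc_mult_mat[of _ n n _ n _ n])
qed

abbreviation real_diag_mat :: "nat \<Rightarrow> (nat \<Rightarrow> real) \<Rightarrow> complex mat" where
  "real_diag_mat n D \<equiv> Matrix.mat n n (\<lambda>(i, j). if i = j then of_real (D i) else 0)"

section \<open>Construction of an orthonormal eigenbasis\<close>

lemma complex_eigenvector_exists:
  fixes A :: "complex mat"
  assumes "A \<in> carrier_mat n n" "0 < n"
  obtains v e where "v \<in> carrier_vec n" "v \<noteq> 0\<^sub>v n" "A *\<^sub>v v = e \<cdot>\<^sub>v v"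
proof -
  have "degree (char_poly A) = n" using degree_monic_char_poly[OF assms(1)] by simp
  then have "\<not> constant (poly (char_poly A))" using assms(2) by (simp add: constant_degree)
  then obtain e where "poly (char_poly A) e = 0" using fundamental_theorem_of_algebra by blast
  then have "eigenvalue A e" using eigenvalue_root_char_poly[OF assms(1)] by simp
  then show ?thesis using assms(1) that unfolding eigenvalue_def eigenvector_def by auto
qed

text \<open>Complete \<open>v\<close> to a basis and orthogonalize: Gram-Schmidt leaves the head of
  the list alone, so after normalization the first column is still a multiple of
  \<open>v\<close>.\<close>

lemma unitary_extension:
  fixes v :: "complex Matrix.vec"
  assumes v: "v \<in> carrier_vec n" "v \<noteq> 0\<^sub>v n"
  obtains U c where "unitary_mat n U" "c \<noteq> 0" "col U 0 = c \<cdot>\<^sub>v v"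
proof -
  interpret cof_vec_space n "TYPE(complex)" .
  define b where "b = basis_completion v"
  from basis_completion[OF v, folded b_def]
  have dist_b: "distinct b" and indep: "\<not> lin_dep (set b)" and b: "set b \<subseteq> carrier_vec n"
    and hdb: "hd b = v" and len_b: "length b = n" by auto
  have n: "0 < n" using v by (cases n) auto
  from hdb len_b n obtain vs where bv: "b = v # vs" by (cases b) auto
  define ws where "ws = gram_schmidt n b"
  from gram_schmidt_result[OF b dist_b indep refl, folded ws_def]
  have ws: "set ws \<subseteq> carrier_vec n" "corthogonal ws" "length ws = n" by (auto simp: len_b)
  have hdws: "hd ws = v" using gram_schmidt_hd[OF v(1), of vs] by (simp add: ws_def bv)
  have ws_nth: "ws ! i \<in> carrier_vec n" if "i < n" for i using ws that by auto
  define N where "N i = Re ((ws ! i) \<bullet>c (ws ! i))" for i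
  define c where "c i = complex_of_real (1 / sqrt (N i))" for i
  have norm: "(ws ! i) \<bullet>c (ws ! i) = of_real (N i)"
     "0 < N i" if i: "i < n" for i
  proof -
    have "(ws ! i) \<bullet>c (ws ! i) \<ge> 0" by (rule conjugate_square_ge_0_vec)
    \<comment> \<open>The diagonal case of \<open>corthogonal\<close> excludes zero vectors, so
      normalization is possible.\<close>
    moreover have "(ws ! i) \<bullet>c (ws ! i) \<noteq> 0" using corthogonalD[OF ws(2), of i i] i ws(3) by simp
    ultimately show "(ws ! i) \<bullet>c (ws ! i) = of_real (N i)"
     "0 < N i" 
      by (auto simp: N_def less_eq_complex_def complex_eq_iff less_le)
  qed
  define U where "U = Matrix.mat n n (\<lambda>(i, j). c j * (ws ! j) $ i)"
  have U: "U \<in> carrier_mat n n" by (simp add: U_def)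
  have colU: "col U j = c j \<cdot>\<^sub>v ws ! j" if "j < n" for j
    using that ws_nth[OF that] by (auto simp: U_def intro!: eq_vecI)
  have "mat_adjoint U * U = 1\<^sub>m n"
  proof (rule eq_matI)
    fix i j assume ij: "i < dim_row (1\<^sub>m n)" "j < dim_col (1\<^sub>m n)"
    then have ij: "i < n" "j < n" by auto
    have "(mat_adjoint U * U) $$ (i, j) = (\<Sum>k<n. cnj (c i * (ws ! i) $ k) * (c j * (ws ! j) $ k))"
      using ij U by (simp add: scalar_prod_def atLeast0LessThan) (simp add: U_def)
    also have "\<dots> = cnj (c i) * c j * ((ws ! j) \<bullet>c (ws ! i))"
      using ws_nth ij by (simp add: scalar_prod_def sum_distrib_left atLeast0LessThan mult_ac carrier_vecD[OF ws_nth])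
    also have "\<dots> = (if i = j then 1 else 0)"
    proof (cases "i = j")
      case True
      have "cnj (c i) * c i * ((ws ! i) \<bullet>c (ws ! i)) = 1"
        using norm(2)[OF ij(1)]
        by (simp add: norm(1)[OF ij(1)] c_def flip: of_real_mult)
      then show ?thesis using True by simp
    next
      case False
      then show ?thesis using corthogonalD[OF ws(2), of j i] ij ws(3) by auto
    qed
    finally show "(mat_adjoint U * U) $$ (i, j) = 1\<^sub>m n $$ (i, j)" using ij by simp
  qed (use U in auto)
  then have "unitary_mat n U" using U by (rule unitary_matI[rotated])
  moreover have "c 0 \<noteq> 0" using norm(2)[OF n] by (simp add: c_def)
  moreover have "col U 0 = c 0 \<cdot>\<^sub>v v" using colU[OF n] hdws n ws(3) by (cases ws) auto
  ultimately show ?thesis using that by blast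
qed


lemma hermitian_mat_adjoint_mult:
  assumes "hermitian n A" "U \<in> carrier_mat n m"
  shows "hermitian m (mat_adjoint U * A * U)"
proof -
  have A: "A \<in> carrier_mat n n" "mat_adjoint A = A"
    using assms by (auto simp: hermitian_def)
  have "mat_adjoint (mat_adjoint U * A * U) = mat_adjoint U * (A * U)"
    using A assms(2)
    by (simp add: mat_adjoint_mult[of _ m n _ m] mat_adjoint_mult[of _ m n _ n]
        mult_carrier_mat[of _ m n _ n])
  also have "\<dots> = mat_adjoint U * A * U"
    using A assms(2) by (simp add: assoc_mult_mat[of _ m n _ n _ m])
  finally show ?thesis
    using A assms(2) by (simp add: hermitian_def mult_carrier_mat[of _ m n _ m] mult_carrier_mat[of _ m n _ n])
qed

text \<open>Deflation: in a basis that starts with an eigenvector the first column is zero below the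
  diagonal, Hermitian symmetry clears the first row too, and the remaining block is Hermitian of
  size one less.\<close>

theorem hermitian_unitary_diagonalization:
  assumes "hermitian n A"
  shows "\<exists>U D. unitary_mat n U \<and> mat_adjoint U * A * U = real_diag_mat n D"
  using assms
proof (induction n arbitrary: A)
  case 0
  have "unitary_mat 0 (1\<^sub>m 0)" by (rule unitary_matI) auto
  moreover have "mat_adjoint (1\<^sub>m 0) * A * 1\<^sub>m 0 = real_diag_mat 0 (\<lambda>_. 0)"
    by (rule eq_matI) auto
  ultimately show ?case by (intro exI conjI)
next
  case (Suc m)
  let ?n = "Suc m"
  have A: "A \<in> carrier_mat ?n ?n" using Suc.prems by (simp add: hermitian_def)
  obtain v e where v: "v \<in> carrier_vec ?n" "v \<noteq> 0\<^sub>v ?n" "A *\<^sub>v v = e \<cdot>\<^sub>v v"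
    using complex_eigenvector_exists[OF A] by blast
  obtain U c where U: "unitary_mat ?n U" and c: "col U 0 = c \<cdot>\<^sub>v v"
    using unitary_extension[OF v(1,2)] by blast
  have Uc: "U \<in> carrier_mat ?n ?n" "mat_adjoint U * U = 1\<^sub>m ?n" using U by (auto simp: unitary_mat_def)
  define B where "B = mat_adjoint U * A * U"
  have herm: "hermitian ?n B" unfolding B_def using Suc.prems Uc by (intro hermitian_mat_adjoint_mult)
  then have B: "B \<in> carrier_mat ?n ?n" "mat_adjoint B = B" by (auto simp: hermitian_def)
  have cnj_B: "B $$ (j, i) = cnj (B $$ (i, j))" if "i < ?n" "j < ?n" for i j
    using arg_cong[OF B(2), of "\<lambda>M. M $$ (j, i)"] that B(1) by simp
  have AU: "A *\<^sub>v col U 0 = e \<cdot>\<^sub>v col U 0"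
    using v A by (simp add: c mult_mat_vec smult_smult_assoc mult.commute)
  have col0: "B $$ (i, 0) = (if i = 0 then e else 0)" if i: "i < ?n" for i
  proof -
    have "B $$ (i, 0) = (mat_adjoint U * (A * U)) $$ (i, 0)"
      using Uc A by (simp add: B_def assoc_mult_mat[of _ ?n ?n _ ?n _ ?n])
    also have "\<dots> = Matrix.row (mat_adjoint U) i \<bullet> col (A * U) 0"
      using Uc A i by (intro index_mult_mat(1)) auto
    also have "col (A * U) 0 = A *\<^sub>v col U 0"
      using Uc A by (intro col_mult2) auto
    also have "Matrix.row (mat_adjoint U) i \<bullet> \<dots> = e * (Matrix.row (mat_adjoint U) i \<bullet> col U 0)"
      using Uc A i by (simp add: AU)
    also have "Matrix.row (mat_adjoint U) i \<bullet> col U 0 = (mat_adjoint U * U) $$ (i, 0)"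
      using Uc(1) i by simp
    finally show ?thesis using i by (simp add: Uc(2))
  qed
  \<comment> \<open>The eigenvalue is a diagonal entry of the Hermitian matrix \<open>B\<close>,
    hence real.\<close>
  have e: "e = of_real (Re e)"
    using cnj_B[of 0 0] col0[of 0] by (simp add: complex_eq_iff)
  define B3 where "B3 = Matrix.mat m m (\<lambda>(i, j). B $$ (Suc i, Suc j))"
  have B3: "B3 \<in> carrier_mat m m" by (simp add: B3_def)
  define E where "E = Matrix.mat 1 1 (\<lambda>_. e)"
  have E: "E \<in> carrier_mat 1 1" by (simp add: E_def)
  have Bblock: "B = four_block_mat E (0\<^sub>m 1 m) (0\<^sub>m m 1) B3"
  proof (rule eq_matI)
    fix i j assume "i < dim_row (four_block_mat E (0\<^sub>m 1 m) (0\<^sub>m m 1) B3)"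
      "j < dim_col (four_block_mat E (0\<^sub>m 1 m) (0\<^sub>m m 1) B3)"
    then have ij: "i < ?n" "j < ?n" by (auto simp: E_def B3_def)
    show "B $$ (i, j) = four_block_mat E (0\<^sub>m 1 m) (0\<^sub>m m 1) B3 $$ (i, j)"
      using ij col0 cnj_B[of j 0] by (cases i; cases j) (auto simp: E_def B3_def)
  qed (use B in \<open>auto simp: E_def B3_def\<close>)
  have "hermitian m B3"
    unfolding hermitian_def using B3
  proof (intro conjI eq_matI)
    fix i j assume ij: "i < dim_row B3" "j < dim_col B3"
    then show "mat_adjoint B3 $$ (i, j) = B3 $$ (i, j)"
      using cnj_B[of "Suc j" "Suc i"] by (simp add: B3_def)
  qed auto
  from Suc.IH[OF this] obtain V D where V: "unitary_mat m V" "mat_adjoint V * B3 * V = real_diag_mat m D"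
    by blast
  have Vc: "V \<in> carrier_mat m m" "mat_adjoint V * V = 1\<^sub>m m" using V by (auto simp: unitary_mat_def)
  \<comment> \<open>\<open>W\<close> fixes the eigenvector already split off and diagonalizes the
    remaining block, so \<open>U * W\<close> is the required unitary.\<close>
  define W where "W = four_block_mat (1\<^sub>m 1) (0\<^sub>m 1 m) (0\<^sub>m m 1) V"
  have adjW: "mat_adjoint W = four_block_mat (1\<^sub>m 1) (0\<^sub>m 1 m) (0\<^sub>m m 1) (mat_adjoint V)"
  proof -
    have "mat_adjoint (0\<^sub>m 1 m :: complex mat) = 0\<^sub>m m 1" "mat_adjoint (0\<^sub>m m 1 :: complex mat) = 0\<^sub>m 1 m"
      by (auto intro!: eq_matI)
    then show ?thesis
      unfolding W_def by (subst mat_adjoint_four_block[of _ 1 1 _ m _ m]) (use Vc in auto)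
  qed
  have Wc: "W \<in> carrier_mat ?n ?n"
    using four_block_carrier_mat[of "1\<^sub>m 1" 1 1 V m m "0\<^sub>m 1 m" "0\<^sub>m m 1"] Vc by (simp add: W_def)
  have W: "unitary_mat ?n W"
  proof (rule unitary_matI[OF Wc])
    have "mat_adjoint W * W = four_block_mat (1\<^sub>m 1) (0\<^sub>m 1 m) (0\<^sub>m m 1) (1\<^sub>m m)"
      unfolding adjW unfolding W_def
      using Vc by (subst mult_block_diag_mat) auto
    also have "\<dots> = 1\<^sub>m ?n" by (rule eq_matI) auto
    finally show "mat_adjoint W * W = 1\<^sub>m ?n" .
  qed
  have "mat_adjoint W * B * W = four_block_mat E (0\<^sub>m 1 m) (0\<^sub>m m 1) (mat_adjoint V * B3 * V)"
    unfolding adjW Bblock unfolding W_def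
    using Vc B3 E by (simp add: mult_block_diag_mat mult_carrier_mat[of _ m m])
  also have "\<dots> = real_diag_mat ?n (\<lambda>i. if i = 0 then Re e else D (i - 1))"
    unfolding V(2) by (rule eq_matI) (use e in \<open>auto simp: E_def\<close>)
  also have "mat_adjoint W * B * W = mat_adjoint (U * W) * A * (U * W)"
    unfolding B_def using Uc(1) Wc A
    by (simp add: mat_adjoint_mult[of _ ?n ?n] assoc_mult_mat[of _ ?n ?n _ ?n _ ?n]
        mult_carrier_mat[of _ ?n ?n _ ?n])
  finally show ?case using unitary_mat_mult[OF U W] by (intro exI conjI)
qed

section \<open>Measurement in the eigenbasis\<close>

text \<open>The columns of an idempotent are fixed by it, hence by the other projection. This gives
  \<open>P * Q = Q\<close> and \<open>Q * P = P\<close>, and taking adjoints turns the latter into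
  \<open>P * Q = P\<close>.\<close>

lemma orthogonal_projection_unique:
  fixes P Q :: "complex mat"
  assumes P: "P \<in> carrier_mat n n" "P * P = P" "mat_adjoint P = P"
    and Q: "Q \<in> carrier_mat n n" "Q * Q = Q" "mat_adjoint Q = Q"
    and fixed: "\<And>v. v \<in> carrier_vec n \<Longrightarrow> P *\<^sub>v v = v \<longleftrightarrow> Q *\<^sub>v v = v"
  shows "P = Q"
proof -
  have absorb: "A * B = B"
    if A: "A \<in> carrier_mat n n" and B: "B \<in> carrier_mat n n" "B * B = B"
      and imp: "\<And>v. v \<in> carrier_vec n \<Longrightarrow> B *\<^sub>v v = v \<Longrightarrow> A *\<^sub>v v = v" for A B :: "complex mat"
  proof (rule mat_col_eqI)
    fix j assume j: "j < dim_col B"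
    have "B *\<^sub>v col B j = col B j"
      using col_mult2[of B n n B n j] B j by simp
    then have "A *\<^sub>v col B j = col B j" using B(1) j by (intro imp) auto
    then show "col (A * B) j = col B j" using col_mult2[of A n n B n j] A B j by simp
  qed (use A B in auto)
  have "P * Q = Q" by (rule absorb[OF P(1) Q(1,2)]) (rule fixed[THEN iffD2])
  moreover have "Q * P = P" by (rule absorb[OF Q(1) P(1,2)]) (rule fixed[THEN iffD1])
  then have "mat_adjoint (Q * P) = P" using P by simp
  then have "P * Q = P" using P Q by (simp add: mat_adjoint_mult[of _ n n])
  ultimately show ?thesis by simp
qed

section \<open>Spectral projections in a fixed eigenbasis\<close>

locale diagonalized =
  fixes n :: nat and A U :: "complex mat" and D :: "nat \<Rightarrow> real"
  assumes A: "A \<in> carrier_mat n n" and U: "unitary_mat n U"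
    and diag: "mat_adjoint U * A * U = real_diag_mat n D"
begin

lemma U_carrier [simp]: "U \<in> carrier_mat n n"
  and U_left [simp]: "mat_adjoint U * U = 1\<^sub>m n"
  and U_right [simp]: "U * mat_adjoint U = 1\<^sub>m n"
  using U by (auto simp: unitary_mat_def)

lemma U_cancel [simp]:
  "X \<in> carrier_mat n m \<Longrightarrow> mat_adjoint U * (U * X) = X"
  "X \<in> carrier_mat n m \<Longrightarrow> U * (mat_adjoint U * X) = X"
  by (simp_all flip: assoc_mult_mat[of _ n n _ n _ m])

lemma U_cancel_vec [simp]:
  "v \<in> carrier_vec n \<Longrightarrow> mat_adjoint U *\<^sub>v (U *\<^sub>v v) = v"
  "v \<in> carrier_vec n \<Longrightarrow> U *\<^sub>v (mat_adjoint U *\<^sub>v v) = v"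
  by (simp_all flip: assoc_mult_mat_vec[of _ n n _ n])

lemma U_mult_vec_eq_iff:
  assumes "v \<in> carrier_vec n" "w \<in> carrier_vec n"
  shows "U *\<^sub>v v = U *\<^sub>v w \<longleftrightarrow> v = w"
proof
  assume "U *\<^sub>v v = U *\<^sub>v w"
  then have "mat_adjoint U *\<^sub>v (U *\<^sub>v v) = mat_adjoint U *\<^sub>v (U *\<^sub>v w)" by (rule arg_cong)
  then show "v = w" unfolding U_cancel_vec(1)[OF assms(1)] U_cancel_vec(1)[OF assms(2)] .
qed simp

lemma A_eq: "A = U * real_diag_mat n D * mat_adjoint U"
  using A by (simp add: diag[symmetric] assoc_mult_mat[of _ n n _ n _ n] mult_carrier_mat[of _ n n _ n])

lemma real_diag_mult_vec:
  "w \<in> carrier_vec n \<Longrightarrow> i < n \<Longrightarrow> (real_diag_mat n f *\<^sub>v w) $ i = of_real (f i) * w $ i"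
  by (simp add: scalar_prod_def if_distrib[of "\<lambda>x. x * _"] sum.delta cong: if_cong)

text \<open>The sum of the rank-one projections onto those columns of \<open>U\<close> that belong
  to the eigenvalue \<open>l\<close>.\<close>

definition spectral_proj :: "real \<Rightarrow> complex mat" where
  "spectral_proj l = U * real_diag_mat n (\<lambda>i. if D i = l then 1 else 0) * mat_adjoint U"

lemma conj_mult_vec:
  assumes "M \<in> carrier_mat n n" "v \<in> carrier_vec n"
  shows "(U * M * mat_adjoint U) *\<^sub>v v = U *\<^sub>v (M *\<^sub>v (mat_adjoint U *\<^sub>v v))"
  using assms by (simp add: assoc_mult_mat_vec[of _ n n _ n] mult_carrier_mat[of _ n n _ n] mult_mat_vec_carrier[of _ n n])

text \<open>In the coordinates given by the adjoint of \<open>U\<close> the equation decouples into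
  scalar ones. With \<open>D\<close> for \<open>f\<close> it describes the eigenvectors of
  \<open>A\<close>; with a 0/1 diagonal and \<open>l = 1\<close>, the vectors fixed by a spectral
  projection.\<close>

lemma conj_mult_vec_eq_iff:
  assumes "v \<in> carrier_vec n"
  shows "(U * real_diag_mat n f * mat_adjoint U) *\<^sub>v v = of_real l \<cdot>\<^sub>v v \<longleftrightarrow>
    (\<forall>i<n. (mat_adjoint U *\<^sub>v v) $ i = 0 \<or> f i = l)"
proof -
  define w where "w = mat_adjoint U *\<^sub>v v"
  have w: "w \<in> carrier_vec n" unfolding w_def
    by (rule mult_mat_vec_carrier[of _ n n]) (use assms in auto)
  have v: "v = U *\<^sub>v w" using assms by (simp add: w_def)
  have Dw: "real_diag_mat n f *\<^sub>v w \<in> carrier_vec n"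
    by (rule mult_mat_vec_carrier[of _ n n]) (use w in auto)
  have "(U * real_diag_mat n f * mat_adjoint U) *\<^sub>v v = U *\<^sub>v (real_diag_mat n f *\<^sub>v w)"
    using assms by (simp add: conj_mult_vec w_def)
  moreover have "of_real l \<cdot>\<^sub>v v = U *\<^sub>v (of_real l \<cdot>\<^sub>v w)"
    unfolding v using w mult_mat_vec[of U n n w "of_real l"] by simp
  ultimately have "(U * real_diag_mat n f * mat_adjoint U) *\<^sub>v v = of_real l \<cdot>\<^sub>v v \<longleftrightarrow>
    U *\<^sub>v (real_diag_mat n f *\<^sub>v w) = U *\<^sub>v (of_real l \<cdot>\<^sub>v w)" by simp
  also have "\<dots> \<longleftrightarrow> real_diag_mat n f *\<^sub>v w = of_real l \<cdot>\<^sub>v w"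
    by (intro U_mult_vec_eq_iff Dw) (use w in simp)
  also have "\<dots> \<longleftrightarrow> (\<forall>i<n. (real_diag_mat n f *\<^sub>v w) $ i = of_real l * w $ i)"
    using w carrier_vecD[OF Dw]
    by (intro iffI allI impI eq_vecI) (simp_all del: index_mult_mat_vec dim_mult_mat_vec)
  also have "\<dots> \<longleftrightarrow> (\<forall>i<n. w $ i = 0 \<or> f i = l)"
    using w by (simp add: real_diag_mult_vec disj_commute del: index_mult_mat_vec)
  finally show ?thesis by (simp add: w_def)
qed

text \<open>Resolves the definite description: the explicit matrix gives existence, and orthogonal
  projections with the same fixed vectors coincide.\<close>

lemma eig_proj_eq: "eig_proj n A l = spectral_proj l"
proof -
  let ?E = "real_diag_mat n (\<lambda>i. if D i = l then 1 else 0)"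
  have E: "?E * ?E = ?E" "mat_adjoint ?E = ?E"
    by (rule eq_matI; auto simp: scalar_prod_def sum.delta if_distrib cong: if_cong)+
  have car: "spectral_proj l \<in> carrier_mat n n" by (auto simp: spectral_proj_def intro!: mult_carrier_mat)
  have idem: "spectral_proj l * spectral_proj l = spectral_proj l"
  proof -
    have "spectral_proj l * spectral_proj l = U * ((?E * ?E) * mat_adjoint U)"
      by (simp add: spectral_proj_def assoc_mult_mat[of _ n n _ n _ n] mult_carrier_mat[of _ n n _ n] U_cancel(1)[of _ n])
    also have "\<dots> = spectral_proj l"
      unfolding E by (simp add: spectral_proj_def assoc_mult_mat[of _ n n _ n _ n] mult_carrier_mat[of _ n n _ n])
    finally show ?thesis .
  qed
  have adj: "mat_adjoint (spectral_proj l) = spectral_proj l"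
    by (simp add: spectral_proj_def mat_adjoint_mult[of _ n n _ n] E assoc_mult_mat[of _ n n _ n _ n] mult_carrier_mat[of _ n n _ n])
  have fixed: "spectral_proj l *\<^sub>v v = v \<longleftrightarrow> A *\<^sub>v v = of_real l \<cdot>\<^sub>v v" if "v \<in> carrier_vec n" for v
    using conj_mult_vec_eq_iff[OF that, of "\<lambda>i. if D i = l then 1 else 0" 1]
      conj_mult_vec_eq_iff[OF that, of D l]
    unfolding A_eq[symmetric] spectral_proj_def by auto
  show ?thesis
    unfolding eig_proj_def
  proof (rule the_equality)
    fix P assume P: "P \<in> carrier_mat n n \<and> P * P = P \<and> mat_adjoint P = P \<and>
      (\<forall>v\<in>carrier_vec n. (P *\<^sub>v v = v) = (A *\<^sub>v v = complex_of_real l \<cdot>\<^sub>v v))"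
    then show "P = spectral_proj l"
      using car idem adj fixed by (intro orthogonal_projection_unique[of P n "spectral_proj l"]) simp_all
  qed (use car idem adj fixed in auto)
qed

lemma eigenvalue_D: "i < n \<Longrightarrow> eigenvalue A (of_real (D i))"
proof -
  assume i: "i < n"
  have "mat_adjoint U *\<^sub>v col U i = col (1\<^sub>m n) i"
    using col_mult2[of "mat_adjoint U" n n U n i] i by simp
  then have "mat_adjoint U *\<^sub>v col U i = unit_vec n i" using i by simp
  then have "A *\<^sub>v col U i = of_real (D i) \<cdot>\<^sub>v col U i"
    using conj_mult_vec_eq_iff[of "col U i" D "D i"] i unfolding A_eq[symmetric]
    by (auto simp: carrier_vecI)
  moreover have "col U i \<noteq> 0\<^sub>v n"
  proof
    assume "col U i = 0\<^sub>v n"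
    then have "unit_vec n i = mat_adjoint U *\<^sub>v (0\<^sub>v n)"
      using \<open>mat_adjoint U *\<^sub>v col U i = unit_vec n i\<close> by simp
    then have "unit_vec n i $ i = (mat_adjoint U *\<^sub>v (0\<^sub>v n)) $ i" by simp
    then show False using i carrier_matD[OF U_carrier] by (simp add: scalar_prod_def)
  qed
  ultimately show ?thesis
    using A i carrier_matD[OF U_carrier] unfolding eigenvalue_def eigenvector_def
    by (metis carrier_matD(1) carrier_vecI dim_col)
qed

end

section \<open>Traces and outcome laws\<close>

lemma mtrace_mult_comm:
  assumes "X \<in> carrier_mat n m" "Y \<in> carrier_mat m n"
  shows "mtrace (X * Y) = mtrace (Y * X)"
proof -
  have "mtrace (X * Y) = (\<Sum>i<n. \<Sum>j<m. X $$ (i,j) * Y $$ (j,i))"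
    using assms by (simp add: mtrace_def scalar_prod_def atLeast0LessThan)
  also have "\<dots> = (\<Sum>j<m. \<Sum>i<n. X $$ (i,j) * Y $$ (j,i))" by (rule sum.swap)
  also have "\<dots> = mtrace (Y * X)"
    using assms by (simp add: mtrace_def scalar_prod_def atLeast0LessThan mult.commute)
  finally show ?thesis .
qed

lemma conj_diag_entry:
  fixes R U :: "complex mat"
  assumes "R \<in> carrier_mat n n" "U \<in> carrier_mat n m" "i < m"
  shows "(mat_adjoint U * R * U) $$ (i, i) = (R *\<^sub>v col U i) \<bullet>c col U i"
proof -
  have "(mat_adjoint U * R * U) $$ (i, i) = (mat_adjoint U * (R * U)) $$ (i, i)"
    using assms by (simp add: assoc_mult_mat[of _ m n _ n _ m])
  also have "\<dots> = Matrix.row (mat_adjoint U) i \<bullet> col (R * U) i"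
    using assms by (intro index_mult_mat(1)) auto
  also have "col (R * U) i = R *\<^sub>v col U i"
    using assms by (intro col_mult2) auto
  also have "Matrix.row (mat_adjoint U) i = conjugate (col U i)"
    using assms by (auto intro!: eq_vecI)
  also have "\<dots> \<bullet> (R *\<^sub>v col U i) = (R *\<^sub>v col U i) \<bullet>c col U i"
    using assms by (intro comm_scalar_prod[of _ n]) (auto intro!: carrier_vecI)
  finally show ?thesis .
qed

context diagonalized
begin

text \<open>Cyclicity of the trace brings \<open>R\<close> into the eigenbasis; the 0/1 diagonal
  then selects the diagonal entries with eigenvalue \<open>l\<close>.\<close>

lemma mtrace_mult_eig_proj:
  assumes R: "R \<in> carrier_mat n n"
  shows "mtrace (R * eig_proj n A l) = (\<Sum>i | i < n \<and> D i = l. (R *\<^sub>v col U i) \<bullet>c col U i)"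
proof -
  let ?E = "real_diag_mat n (\<lambda>i. if D i = l then 1 else 0)"
  have c: "R * U \<in> carrier_mat n n" "mat_adjoint U * R * U \<in> carrier_mat n n" "?E * mat_adjoint U \<in> carrier_mat n n"
    using R by (simp_all add: mult_carrier_mat[of _ n n _ n])
  have "mtrace (R * eig_proj n A l) = mtrace ((R * U * ?E) * mat_adjoint U)"
    using R by (simp add: eig_proj_eq spectral_proj_def assoc_mult_mat[of _ n n _ n _ n] mult_carrier_mat[of _ n n _ n])
  also have "\<dots> = mtrace (mat_adjoint U * (R * U * ?E))"
    using c by (intro mtrace_mult_comm[of _ n n]) (auto simp: mult_carrier_mat[of _ n n _ n])
  also have "mat_adjoint U * (R * U * ?E) = (mat_adjoint U * R * U) * ?E"
    using R by (simp add: assoc_mult_mat[of _ n n _ n _ n] mult_carrier_mat[of _ n n _ n])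
  also have "mtrace \<dots> = (\<Sum>i<n. if D i = l then (mat_adjoint U * R * U) $$ (i, i) else 0)"
    using c(2) unfolding mtrace_def
    by (intro sum.cong) (auto simp: scalar_prod_def if_distrib sum.delta cong: if_cong)
  also have "\<dots> = (\<Sum>i | i < n \<and> D i = l. (mat_adjoint U * R * U) $$ (i, i))"
    by (subst sum.inter_filter[symmetric]) (auto intro!: sum.cong)
  finally show ?thesis using conj_diag_entry[OF R U_carrier] by simp
qed

lemma density_weights:
  assumes "density_op n \<rho>"
  shows "\<And>i. 0 \<le> qform \<rho> (col U i)" "(\<Sum>i<n. qform \<rho> (col U i)) = 1"
proof -
  have R: "\<rho> \<in> carrier_mat n n" "mtrace \<rho> = 1"
    and pos: "\<And>v. v \<in> carrier_vec n \<Longrightarrow> 0 \<le> Re ((\<rho> *\<^sub>v v) \<bullet>c v)"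
    using assms by (auto simp: density_op_def hermitian_def)
  show "0 \<le> qform \<rho> (col U i)" for i
    unfolding qform_def using carrier_matD[OF U_carrier] by (intro pos carrier_vecI) simp
  have "mtrace (mat_adjoint U * (\<rho> * U)) = mtrace ((\<rho> * U) * mat_adjoint U)"
    using R by (intro mtrace_mult_comm[of _ n n]) (auto simp: mult_carrier_mat[of _ n n _ n])
  also have "\<dots> = 1"
    using R by (simp add: assoc_mult_mat[of _ n n _ n _ n])
  finally have "mtrace (mat_adjoint U * \<rho> * U) = 1"
    using R by (simp add: assoc_mult_mat[of _ n n _ n _ n])
  then have "(\<Sum>i<n. (\<rho> *\<^sub>v col U i) \<bullet>c col U i) = 1"
    using conj_diag_entry[OF R(1) U_carrier] by (simp add: mtrace_def carrier_matD[OF U_carrier])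
  then show "(\<Sum>i<n. qform \<rho> (col U i)) = 1"
    unfolding qform_def by (simp flip: Re_sum)
qed

text \<open>Refines the measurement to one that reports a column index instead of an eigenvalue.
  Equal eigenvalues are merged by \<open>D\<close>, so degenerate observables need no separate
  treatment.\<close>

lemma meas_pmf_eq:
  assumes "density_op n \<rho>"
  obtains r where "meas_pmf n \<rho> A = map_pmf D r" "set_pmf r \<subseteq> {..<n}"
    "\<And>i. i < n \<Longrightarrow> pmf r i = qform \<rho> (col U i)"
proof -
  define f where "f i = (if i < n then qform \<rho> (col U i) else 0)" for i
  have f0: "0 \<le> f i" for i using density_weights(1)[OF assms] by (simp add: f_def)
  have "(\<integral>\<^sup>+i. ennreal (f i) \<partial>count_space UNIV) = (\<Sum>i<n. ennreal (f i))"
    by (intro nn_integral_count_space'[of "{..<n}"]) (auto simp: f_def)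
  also have "\<dots> = ennreal (\<Sum>i<n. f i)" using f0 by (intro sum_ennreal)
  also have "\<dots> = 1" using density_weights(2)[OF assms] by (simp add: f_def)
  finally have int: "(\<integral>\<^sup>+i. ennreal (f i) \<partial>count_space UNIV) = 1" .
  define r where "r = embed_pmf f"
  have pmf_r: "pmf r i = f i" for i unfolding r_def using f0 int by (rule pmf_embed_pmf)
  have supp: "set_pmf r \<subseteq> {..<n}" by (auto simp: set_pmf_eq pmf_r f_def split: if_splits)
  have R: "\<rho> \<in> carrier_mat n n" using assms by (auto simp: density_op_def hermitian_def)
  have "meas_pmf n \<rho> A = embed_pmf (pmf (map_pmf D r))"
    unfolding meas_pmf_def
  proof (intro arg_cong[of _ _ embed_pmf] ext)
    fix x
    have "pmf (map_pmf D r) x = measure r (D -` {x})" by (rule pmf_map)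
    also have "\<dots> = measure r {i. i < n \<and> D i = x}"
      using supp by (intro measure_pmf.finite_measure_eq_AE) (auto simp: AE_measure_pmf_iff)
    also have "\<dots> = (\<Sum>i | i < n \<and> D i = x. f i)"
      by (subst measure_measure_pmf_finite) (auto simp: pmf_r)
    also have "\<dots> = (if eigenvalue A (of_real x) then Re (mtrace (\<rho> * eig_proj n A x)) else 0)"
    proof (cases "eigenvalue A (of_real x)")
      case True
      then show ?thesis by (simp add: mtrace_mult_eig_proj[OF R] f_def qform_def)
    next
      case False
      \<comment> \<open>Every \<open>D i\<close> is an eigenvalue, so the value 0 prescribed at
        non-eigenvalues is the true mass.\<close>
      then have "{i. i < n \<and> D i = x} = {}" using eigenvalue_D by auto
      then show ?thesis using False by (simp only: sum.empty if_False)
    qed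
    finally show "(if eigenvalue A (of_real x) then Re (mtrace (\<rho> * eig_proj n A x)) else 0)
      = pmf (map_pmf D r) x" ..
  qed
  \<comment> \<open>\<open>embed_pmf\<close> recovers a distribution from its own mass function, and
    the function in \<open>meas_pmf\<close> has just been identified as one.\<close>
  then have "meas_pmf n \<rho> A = map_pmf D r"
    by (simp add: type_definition.Rep_inverse[OF td_pmf_embed_pmf])
  then show ?thesis using supp pmf_r by (intro that[of r]) (auto simp: f_def)
qed

end

section \<open>The two hard environments\<close>

text \<open>The pure state of \<psi> mixed with white noise, entry by entry.\<close>

definition mixed_state :: "nat \<Rightarrow> real \<Rightarrow> complex Matrix.vec \<Rightarrow> complex mat" where
  "mixed_state n \<Delta> \<psi> = Matrix.mat n n (\<lambda>(i, j).
     (if i = j then of_real ((1 - \<Delta>) / real n) else 0) + of_real \<Delta> * (\<psi> $ i * cnj (\<psi> $ j)))"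

lemma mixed_state_mult_vec:
  assumes "\<psi> \<in> carrier_vec n" "v \<in> carrier_vec n"
  shows "mixed_state n \<Delta> \<psi> *\<^sub>v v =
    of_real ((1 - \<Delta>) / real n) \<cdot>\<^sub>v v + (of_real \<Delta> * (v \<bullet>c \<psi>)) \<cdot>\<^sub>v \<psi>"
proof (rule eq_vecI)
  fix i assume "i < dim_vec (of_real ((1 - \<Delta>) / real n) \<cdot>\<^sub>v v + (of_real \<Delta> * (v \<bullet>c \<psi>)) \<cdot>\<^sub>v \<psi>)"
  then have i: "i < n" using assms by simp
  have "(mixed_state n \<Delta> \<psi> *\<^sub>v v) $ i
      = (\<Sum>j<n. ((if i = j then of_real ((1 - \<Delta>) / real n) else 0) + of_real \<Delta> * (\<psi> $ i * cnj (\<psi> $ j))) * v $ j)"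
    using assms i by (simp add: mixed_state_def scalar_prod_def atLeast0LessThan)
  also have "\<dots> = (\<Sum>j<n. (if i = j then of_real ((1 - \<Delta>) / real n) * v $ j else 0)
      + of_real \<Delta> * \<psi> $ i * (v $ j * cnj (\<psi> $ j)))"
    by (intro sum.cong) (auto simp: distrib_left distrib_right mult_ac)
  also have "\<dots> = of_real ((1 - \<Delta>) / real n) * v $ i + of_real \<Delta> * \<psi> $ i * (\<Sum>j<n. v $ j * cnj (\<psi> $ j))"
    using i by (simp only: sum.distrib sum_distrib_left) (simp add: sum.delta)
  finally show "(mixed_state n \<Delta> \<psi> *\<^sub>v v) $ i
      = (of_real ((1 - \<Delta>) / real n) \<cdot>\<^sub>v v + (of_real \<Delta> * (v \<bullet>c \<psi>)) \<cdot>\<^sub>v \<psi>) $ i"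
    using assms i by (simp add: scalar_prod_def atLeast0LessThan)
qed (use assms in \<open>simp add: mixed_state_def\<close>)

text \<open>The rank-one part contributes \<Delta> times a squared modulus. The bound serves twice:
  for positivity of the state and as the floor under all outcome probabilities.\<close>

lemma qform_mixed_state_ge:
  assumes \<psi>: "\<psi> \<in> carrier_vec n" and v: "v \<in> carrier_vec n" and "0 \<le> \<Delta>"
  shows "(1 - \<Delta>) / real n * Re (v \<bullet>c v) \<le> qform (mixed_state n \<Delta> \<psi>) v"
proof -
  have swap: "\<psi> \<bullet>c v = cnj (v \<bullet>c \<psi>)"
    using \<psi> v by (simp add: scalar_prod_def mult.commute)
  have "(mixed_state n \<Delta> \<psi> *\<^sub>v v) \<bullet>c v
      = of_real ((1 - \<Delta>) / real n) * (v \<bullet>c v) + of_real \<Delta> * (v \<bullet>c \<psi>) * (\<psi> \<bullet>c v)"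
    using \<psi> v by (simp add: mixed_state_mult_vec add_scalar_prod_distrib[of _ n])
  also have "\<dots> = of_real ((1 - \<Delta>) / real n) * (v \<bullet>c v) + of_real (\<Delta> * (cmod (v \<bullet>c \<psi>))\<^sup>2)"
    by (simp add: swap mult.assoc flip: complex_norm_square)
  finally have "qform (mixed_state n \<Delta> \<psi>) v
      = (1 - \<Delta>) / real n * Re (v \<bullet>c v) + \<Delta> * (cmod (v \<bullet>c \<psi>))\<^sup>2"
    unfolding qform_def by (simp only: plus_complex.sel Re_complex_of_real) simp
  then show ?thesis using assms(3) by simp
qed

lemma unit_vec_dim_pos:
  assumes "\<psi> \<in> carrier_vec n" "\<psi> \<bullet>c \<psi> = (1 :: complex)"
  shows "0 < n"
  using assms by (cases n) (auto simp: scalar_prod_def)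

text \<open>For a traceless \<open>B\<close> the noise drops out and the mean reward is \<Delta>
  times the quadratic form; for the identity matrix the formula gives the trace of the
  state.\<close>

lemma mtrace_mixed_state_mult:
  assumes \<psi>: "\<psi> \<in> carrier_vec n" and B: "B \<in> carrier_mat n n"
  shows "mtrace (mixed_state n \<Delta> \<psi> * B)
    = of_real ((1 - \<Delta>) / real n) * mtrace B + of_real \<Delta> * ((B *\<^sub>v \<psi>) \<bullet>c \<psi>)"
proof -
  have "mtrace (mixed_state n \<Delta> \<psi> * B)
      = (\<Sum>i<n. \<Sum>j<n. ((if i = j then of_real ((1 - \<Delta>) / real n) else 0) + of_real \<Delta> * (\<psi> $ i * cnj (\<psi> $ j))) * B $$ (j, i))"
    using B by (simp add: mtrace_def mixed_state_def scalar_prod_def atLeast0LessThan)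
  also have "\<dots> = (\<Sum>i<n. \<Sum>j<n. (if i = j then of_real ((1 - \<Delta>) / real n) * B $$ (j, i) else 0)
      + of_real \<Delta> * (B $$ (j, i) * \<psi> $ i * cnj (\<psi> $ j)))"
    by (intro sum.cong) (auto simp: distrib_left distrib_right mult_ac)
  also have "\<dots> = of_real ((1 - \<Delta>) / real n) * mtrace B
      + of_real \<Delta> * (\<Sum>i<n. \<Sum>j<n. B $$ (j, i) * \<psi> $ i * cnj (\<psi> $ j))"
    using B by (simp only: sum.distrib sum_distrib_left) (simp add: sum.delta mtrace_def sum_distrib_left)
  also have "(\<Sum>i<n. \<Sum>j<n. B $$ (j, i) * \<psi> $ i * cnj (\<psi> $ j)) = (B *\<^sub>v \<psi>) \<bullet>c \<psi>"
    using B \<psi> by (subst sum.swap) (simp add: scalar_prod_def atLeast0LessThan sum_distrib_right)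
  finally show ?thesis .
qed

lemma density_op_mixed_state:
  assumes \<psi>: "\<psi> \<in> carrier_vec n" "\<psi> \<bullet>c \<psi> = 1" and \<Delta>: "0 \<le> \<Delta>" "\<Delta> \<le> 1"
  shows "density_op n (mixed_state n \<Delta> \<psi>)"
  unfolding density_op_def
proof (intro conjI ballI)
  have n: "0 < n" using unit_vec_dim_pos[OF \<psi>] .
  have c: "mixed_state n \<Delta> \<psi> \<in> carrier_mat n n" by (simp add: mixed_state_def)
  have "mat_adjoint (mixed_state n \<Delta> \<psi>) = mixed_state n \<Delta> \<psi>"
    by (rule eq_matI) (auto simp: mixed_state_def)
  with c show "hermitian n (mixed_state n \<Delta> \<psi>)" by (simp add: hermitian_def)
  fix v :: "complex Matrix.vec" assume v: "v \<in> carrier_vec n"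
  have "0 \<le> Re (v \<bullet>c v)" using conjugate_square_ge_0_vec[of v] by (simp add: less_eq_complex_def)
  then have "0 \<le> (1 - \<Delta>) / real n * Re (v \<bullet>c v)" using \<Delta> by simp
  also have "\<dots> \<le> qform (mixed_state n \<Delta> \<psi>) v" using qform_mixed_state_ge[OF \<psi>(1) v \<Delta>(1)] .
  finally show "0 \<le> Re ((mixed_state n \<Delta> \<psi> *\<^sub>v v) \<bullet>c v)" by (simp add: qform_def)
next
  have n: "0 < n" using unit_vec_dim_pos[OF \<psi>] .
  have "mtrace (mixed_state n \<Delta> \<psi>) = mtrace (mixed_state n \<Delta> \<psi> * 1\<^sub>m n)"
    by (simp add: mixed_state_def right_mult_one_mat)
  also have "\<dots> = of_real ((1 - \<Delta>) / real n) * of_nat n + of_real \<Delta>"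
    using \<psi> by (subst mtrace_mixed_state_mult) (auto simp: mtrace_def)
  also have "\<dots> = 1" using n by (simp add: field_simps)
  finally show "mtrace (mixed_state n \<Delta> \<psi>) = 1" .
qed

text \<open>Both outcome laws are images under the same \<open>D\<close> of index laws with floor
  \<open>(1 - \<Delta>) / n\<close>. These are compared as nearly uniform laws, and passing to
  images preserves the bound.\<close>

lemma affinity_meas_pmf_mixed_state:
  assumes A: "hermitian n A" and \<psi>: "\<psi> \<in> carrier_vec n" "\<psi> \<bullet>c \<psi> = 1"
    and \<phi>: "\<phi> \<in> carrier_vec n" "\<phi> \<bullet>c \<phi> = 1" and \<Delta>: "0 \<le> \<Delta>" "\<Delta> \<le> 1/2"
  shows "affinity_ge (1 - (real n * \<Delta>)\<^sup>2 / 2)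
      (meas_pmf n (mixed_state n \<Delta> \<psi>) A) (meas_pmf n (mixed_state n \<Delta> \<phi>) A)"
    "finite (set_pmf (meas_pmf n (mixed_state n \<Delta> \<psi>) A))"
proof -
  obtain U D where UD: "unitary_mat n U" "mat_adjoint U * A * U = real_diag_mat n D"
    using hermitian_unitary_diagonalization[OF A] by blast
  interpret diagonalized n A U D
    using A UD by unfold_locales (auto simp: hermitian_def)
  have den: "density_op n (mixed_state n \<Delta> \<psi>)" "density_op n (mixed_state n \<Delta> \<phi>)"
    using \<psi> \<phi> \<Delta> by (auto intro!: density_op_mixed_state)
  obtain r where r: "meas_pmf n (mixed_state n \<Delta> \<psi>) A = map_pmf D r" "set_pmf r \<subseteq> {..<n}"
    "\<And>i. i < n \<Longrightarrow> pmf r i = qform (mixed_state n \<Delta> \<psi>) (col U i)"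
    using meas_pmf_eq[OF den(1)] by metis
  obtain s where s: "meas_pmf n (mixed_state n \<Delta> \<phi>) A = map_pmf D s" "set_pmf s \<subseteq> {..<n}"
    "\<And>i. i < n \<Longrightarrow> pmf s i = qform (mixed_state n \<Delta> \<phi>) (col U i)"
    using meas_pmf_eq[OF den(2)] by metis
  have unit: "col U i \<in> carrier_vec n" "col U i \<bullet>c col U i = 1" if i: "i < n" for i
  proof -
    show c: "col U i \<in> carrier_vec n" using carrier_matD[OF U_carrier] by (intro carrier_vecI) simp
    have "(mat_adjoint U * 1\<^sub>m n * U) $$ (i, i) = (1\<^sub>m n *\<^sub>v col U i) \<bullet>c col U i"
      using i by (intro conj_diag_entry[OF _ U_carrier]) auto
    then show "col U i \<bullet>c col U i = 1"
      using i c by (simp add: right_mult_one_mat[of _ n])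
  qed
  have "affinity_ge (1 - (real n * \<Delta>)\<^sup>2 / 2) r s"
    using \<Delta> unit_vec_dim_pos[OF \<psi>] r(2) s(2)
  proof (intro affinity_ge_near_uniform)
    fix i assume i: "i < n"
    show "(1 - \<Delta>) / real n \<le> pmf r i"
      using qform_mixed_state_ge[OF \<psi>(1) unit(1)[OF i] \<Delta>(1)] by (simp add: r(3)[OF i] unit(2)[OF i])
    show "(1 - \<Delta>) / real n \<le> pmf s i"
      using qform_mixed_state_ge[OF \<phi>(1) unit(1)[OF i] \<Delta>(1)] by (simp add: s(3)[OF i] unit(2)[OF i])
  qed auto
  then show "affinity_ge (1 - (real n * \<Delta>)\<^sup>2 / 2)
      (meas_pmf n (mixed_state n \<Delta> \<psi>) A) (meas_pmf n (mixed_state n \<Delta> \<phi>) A)"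
    unfolding r(1) s(1) by (rule affinity_ge_map)
  show "finite (set_pmf (meas_pmf n (mixed_state n \<Delta> \<psi>) A))"
    using finite_subset[OF r(2)] by (simp add: r(1))
qed

section \<open>Histories of the interaction\<close>

lemma hist_support:
  assumes "valid_policy k \<pi>" "\<And>i. i < k \<Longrightarrow> finite (set_pmf (meas_pmf d \<rho> (Ob i)))"
  shows "finite (set_pmf (hist d Ob \<rho> \<pi> t)) \<and>
    (\<forall>h\<in>set_pmf (hist d Ob \<rho> \<pi> t). length h = t \<and> fst ` set h \<subseteq> {..<k})"
proof (induction t)
  case (Suc t)
  have \<pi>: "set_pmf (\<pi> t h) \<subseteq> {..<k}" for h using assms(1) by (simp add: valid_policy_def)
  have "finite (set_pmf (\<pi> t h))" for h by (rule finite_subset[OF \<pi>]) simp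
  with Suc \<pi> assms(2) show ?case by (fastforce simp: set_bind_pmf)
qed simp

text \<open>Given the same history, the policy draws its action from the same law in both
  environments, at affinity 1; only the measurement costs a factor \<beta>. As this holds for every
  history, adaptivity gains nothing.\<close>

lemma affinity_hist:
  assumes \<pi>: "valid_policy k \<pi>" and \<beta>: "0 < \<beta>"
    and meas: "\<And>i. i < k \<Longrightarrow> affinity_ge \<beta> (meas_pmf d \<rho> (Ob i)) (meas_pmf d \<sigma> (Ob i))"
    and fin: "\<And>i. i < k \<Longrightarrow> finite (set_pmf (meas_pmf d \<rho> (Ob i)))"
      "\<And>i. i < k \<Longrightarrow> finite (set_pmf (meas_pmf d \<sigma> (Ob i)))"
  shows "affinity_ge (\<beta> ^ t) (hist d Ob \<rho> \<pi> t) (hist d Ob \<sigma> \<pi> t)"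
proof (induction t)
  case 0
  show ?case by (simp add: affinity_ge_refl)
next
  case (Suc t)
  have sub: "set_pmf (\<pi> t h) \<subseteq> {..<k}" for h using \<pi> by (simp add: valid_policy_def)
  have fin\<pi>: "finite (set_pmf (\<pi> t h))" for h by (rule finite_subset[OF sub]) simp
  have step: "affinity_ge (1 * \<beta>)
      (bind_pmf (\<pi> t h) (\<lambda>a. map_pmf (\<lambda>x. h @ [(a, x)]) (meas_pmf d \<rho> (Ob a))))
      (bind_pmf (\<pi> t h) (\<lambda>a. map_pmf (\<lambda>x. h @ [(a, x)]) (meas_pmf d \<sigma> (Ob a))))" for h
  proof (intro affinity_ge_bind affinity_ge_refl fin\<pi> \<beta>)
    fix a assume "a \<in> set_pmf (\<pi> t h) \<union> set_pmf (\<pi> t h)"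
    then have "a < k" using sub[of h] by auto
    then show "finite (set_pmf (map_pmf (\<lambda>x. h @ [(a, x)]) (meas_pmf d \<rho> (Ob a)))) \<and>
        finite (set_pmf (map_pmf (\<lambda>x. h @ [(a, x)]) (meas_pmf d \<sigma> (Ob a)))) \<and>
        affinity_ge \<beta> (map_pmf (\<lambda>x. h @ [(a, x)]) (meas_pmf d \<rho> (Ob a)))
          (map_pmf (\<lambda>x. h @ [(a, x)]) (meas_pmf d \<sigma> (Ob a)))"
      using fin meas by (auto intro!: affinity_ge_map)
  qed
  have fin_step: "finite (set_pmf (bind_pmf (\<pi> t h) (\<lambda>a. map_pmf (\<lambda>x. h @ [(a, x)]) (meas_pmf d \<tau> (Ob a)))))"
    if "\<And>i. i < k \<Longrightarrow> finite (set_pmf (meas_pmf d \<tau> (Ob i)))" for h \<tau>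
    using sub[of h] fin\<pi>[of h] that by (auto simp: set_bind_pmf)
  have "affinity_ge (\<beta> ^ t * \<beta>) (hist d Ob \<rho> \<pi> (Suc t)) (hist d Ob \<sigma> \<pi> (Suc t))"
    unfolding hist.simps
    using hist_support[where Ob = Ob, OF \<pi> fin(1)] hist_support[where Ob = Ob, OF \<pi> fin(2)] step
    by (intro affinity_ge_bind[OF Suc _ _ \<beta>] conjI fin_step fin) simp_all
  then show ?case by (simp add: mult.commute)
qed

lemma sum_list_ge_count:
  assumes "\<And>x. x \<in> set xs \<Longrightarrow> 0 \<le> f x" "\<And>x. x \<in> set xs \<Longrightarrow> P x \<Longrightarrow> c \<le> f x"
  shows "c * real (length (filter P xs)) \<le> (\<Sum>x\<leftarrow>xs. f x :: real)"
  using assms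
proof (induction xs)
  case (Cons x xs)
  then have "c * real (length (filter P xs)) \<le> (\<Sum>x\<leftarrow>xs. f x)" by simp
  then show ?case using Cons.prems[of x] by (auto simp: algebra_simps)
qed simp

text \<open>By tracelessness all mean rewards are \<Delta> times quadratic forms in \<psi>. The best
  mean is at least that of \<open>a\<close>, so each pull of another arm loses at least
  \<open>c * \<Delta>\<close>.\<close>

lemma regret_mixed_state_ge:
  assumes obs: "\<forall>i<k. hermitian d (Ob i) \<and> mtrace (Ob i) = 0"
    and \<psi>: "\<psi> \<in> carrier_vec d" and a: "a < k" and \<Delta>: "0 \<le> \<Delta>"
    and gap: "\<And>i. i < k \<Longrightarrow> i \<noteq> a \<Longrightarrow> c \<le> qform (Ob a) \<psi> - qform (Ob i) \<psi>" and c: "0 \<le> c"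
    and h: "fst ` set h \<subseteq> {..<k}"
  shows "c * \<Delta> * real (length (filter (\<lambda>p. fst p \<noteq> a) h)) \<le> regret k Ob (mixed_state d \<Delta> \<psi>) h"
proof -
  have val: "Re (mtrace (mixed_state d \<Delta> \<psi> * Ob i)) = \<Delta> * qform (Ob i) \<psi>" if "i < k" for i
    using obs that \<psi> by (subst mtrace_mixed_state_mult) (auto simp: hermitian_def qform_def)
  define m where "m = Max ((\<lambda>i. Re (mtrace (mixed_state d \<Delta> \<psi> * Ob i))) ` {..<k})"
  have m: "Re (mtrace (mixed_state d \<Delta> \<psi> * Ob i)) \<le> m" if "i < k" for i
    unfolding m_def using that by (intro Max_ge) auto
  show ?thesis
    unfolding regret_def m_def[symmetric]
  proof (rule sum_list_ge_count)
    fix p assume "p \<in> set h"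
    then have p: "fst p < k" using h by auto
    then show "0 \<le> m - Re (mtrace (mixed_state d \<Delta> \<psi> * Ob (fst p)))" using m by simp
    assume "fst p \<noteq> a"
    then have "c * \<Delta> \<le> (qform (Ob a) \<psi> - qform (Ob (fst p)) \<psi>) * \<Delta>"
      using gap[OF p] \<Delta> by (intro mult_right_mono) auto
    then show "c * \<Delta> \<le> m - Re (mtrace (mixed_state d \<Delta> \<psi> * Ob (fst p)))"
      using m[OF a] p a by (simp add: val algebra_simps)
  qed
qed

theorem mainTheorem5:
  fixes d k a b :: nat and Ob :: "nat \<Rightarrow> complex mat" and \<psi>A \<psi>B :: "complex Matrix.vec"
  assumes obs: "\<forall>i<k. hermitian d (Ob i) \<and> mtrace (Ob i) = 0"
    and ab: "a < k" "b < k" "a \<noteq> b"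
    and eigA: "top_eigvec (Ob a) \<psi>A"
    and eigB: "top_eigvec (Ob b) \<psi>B"
    and sepA: "\<forall>i<k. i \<noteq> a \<longrightarrow> qform (Ob a) \<psi>A > qform (Ob i) \<psi>A"
    and sepB: "\<forall>j<k. j \<noteq> b \<longrightarrow> qform (Ob b) \<psi>B > qform (Ob j) \<psi>B"
  shows "\<exists>C>0. \<forall>(T::nat) \<pi>. valid_policy k \<pi> \<longrightarrow>
           (\<exists>\<rho>. density_op d \<rho> \<and> expected_regret d k Ob \<rho> \<pi> T \<ge> C * sqrt (real T))"
proof -
  have carA: "\<psi>A \<in> carrier_vec d" "\<psi>A \<bullet>c \<psi>A = 1" and carB: "\<psi>B \<in> carrier_vec d" "\<psi>B \<bullet>c \<psi>B = 1"
    using eigA eigB obs ab by (auto simp: top_eigvec_def eigenvector_def hermitian_def)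
  have d: "0 < d" using unit_vec_dim_pos[OF carA] .
  \<comment> \<open>All gaps of both environments; there is at least one because \<open>a\<close>
    and \<open>b\<close> differ. Their minimum depends on neither \<open>T\<close> nor the
    policy.\<close>
  define S where "S = (\<lambda>i. qform (Ob a) \<psi>A - qform (Ob i) \<psi>A) ` ({..<k} - {a})
    \<union> (\<lambda>i. qform (Ob b) \<psi>B - qform (Ob i) \<psi>B) ` ({..<k} - {b})"
  define c where "c = Min S"
  have S: "finite S" "S \<noteq> {}" "\<forall>x\<in>S. 0 < x" using ab sepA sepB by (auto simp: S_def)
  then have c: "0 < c" by (simp add: c_def)
  have gapA: "c \<le> qform (Ob a) \<psi>A - qform (Ob i) \<psi>A" if "i < k" "i \<noteq> a" for i
    unfolding c_def using S that by (intro Min_le) (auto simp: S_def)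
  have gapB: "c \<le> qform (Ob b) \<psi>B - qform (Ob i) \<psi>B" if "i < k" "i \<noteq> b" for i
    unfolding c_def using S that by (intro Min_le) (auto simp: S_def)
  have "\<exists>\<rho>. density_op d \<rho> \<and> c / (16 * real d) * sqrt (real T) \<le> expected_regret d k Ob \<rho> \<pi> T"
    if \<pi>: "valid_policy k \<pi>" for T \<pi>
  \<comment> \<open>Without rounds the bound is 0 and any density matrix will do; the choice of
    \<Delta> in the other case requires a positive \<open>T\<close>.\<close>
  proof (cases "T = 0")
    case True
    have "density_op d (mixed_state d 0 \<psi>A)" using carA by (intro density_op_mixed_state) auto
    moreover have "expected_regret d k Ob (mixed_state d 0 \<psi>A) \<pi> 0 = 0"
      by (simp add: expected_regret_def regret_def)
    ultimately show ?thesis using True by (intro exI[of _ "mixed_state d 0 \<psi>A"]) simp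
  next
    case False
    \<comment> \<open>Makes \<open>(real d * \<Delta>)\<^sup>2\<close> equal to
      \<open>1 / (4 * T)\<close>: one round costs \<open>1 / (8 * T)\<close> of affinity, and by
      Bernoulli's inequality all \<open>T\<close> rounds together cost at most 1/8.\<close>
    define \<Delta> where "\<Delta> = 1 / (2 * real d * sqrt (real T))"
    have T: "1 \<le> sqrt (real T)" using False by simp
    have \<Delta>0: "0 < \<Delta>" using d T by (simp add: \<Delta>_def)
    have "1 * 1 \<le> real d * sqrt (real T)" using d T by (intro mult_mono) auto
    then have \<Delta>1: "\<Delta> \<le> 1/2" by (simp add: \<Delta>_def field_simps)
    define \<beta> where "\<beta> = 1 - (real d * \<Delta>)\<^sup>2 / 2"
    have \<beta>_eq: "\<beta> = 1 - 1 / (8 * real T)"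
      using d T by (simp add: \<beta>_def \<Delta>_def power_divide power_mult_distrib)
    have \<beta>0: "0 < \<beta>" using False by (simp add: \<beta>_eq)
    have \<beta>T: "7/8 \<le> \<beta> ^ T"
      using Bernoulli_inequality[of "- 1 / (8 * real T)" T] False by (simp add: \<beta>_eq field_simps)
    define \<rho> \<sigma> where "\<rho> = mixed_state d \<Delta> \<psi>A" "\<sigma> = mixed_state d \<Delta> \<psi>B"
    have den: "density_op d \<rho>" "density_op d \<sigma>"
      unfolding \<rho>_\<sigma>_def using carA carB \<Delta>0 \<Delta>1 by (auto intro!: density_op_mixed_state)
    have meas: "affinity_ge \<beta> (meas_pmf d \<rho> (Ob i)) (meas_pmf d \<sigma> (Ob i))"
      "finite (set_pmf (meas_pmf d \<rho> (Ob i)))" "finite (set_pmf (meas_pmf d \<sigma> (Ob i)))" if "i < k" for i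
      unfolding \<rho>_\<sigma>_def \<beta>_def using that obs carA carB \<Delta>0 \<Delta>1
      by (auto intro!: affinity_meas_pmf_mixed_state)
    define P Q where "P = hist d Ob \<rho> \<pi> T" "Q = hist d Ob \<sigma> \<pi> T"
    have supp: "finite (set_pmf P)" "finite (set_pmf Q)"
      "\<And>h. h \<in> set_pmf P \<union> set_pmf Q \<Longrightarrow> length h = T \<and> fst ` set h \<subseteq> {..<k}"
      using hist_support[where Ob = Ob and t = T, OF \<pi> meas(2)] hist_support[where Ob = Ob and t = T, OF \<pi> meas(3)]
      unfolding P_Q_def by blast+
    \<comment> \<open>The fraction of rounds spent on arms other than \<open>a\<close>. Dividing by
      \<open>length h\<close> instead of \<open>T\<close> keeps it within [0, 1] for every list, the
      empty one included since division by 0 yields 0.\<close>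
    define u where "u h = real (length (filter (\<lambda>p. fst p \<noteq> a) h)) / real (length h)" for h :: "(nat \<times> real) list"
    have u: "0 \<le> u h" "u h \<le> 1" for h
      by (auto simp: u_def divide_le_eq_1)
    have "affinity_ge (\<beta> ^ T) P Q"
      unfolding P_Q_def using meas by (intro affinity_hist[OF \<pi> \<beta>0])
    then have "(\<beta> ^ T - 1/4) / 2 \<le> measure_pmf.expectation P u + measure_pmf.expectation Q (\<lambda>h. 1 - u h)"
      using supp u by (intro affinity_two_point) auto
    \<comment> \<open>The two-point bound at 7/8 is 5/16, rounded down here.\<close>
    then have test: "1/4 \<le> measure_pmf.expectation P u + measure_pmf.expectation Q (\<lambda>h. 1 - u h)"
      using \<beta>T by simp
    have "measure_pmf.expectation P (\<lambda>h. c * \<Delta> * real T * u h) \<le> expected_regret d k Ob \<rho> \<pi> T"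
      unfolding expected_regret_def P_Q_def[symmetric]
    proof (intro expectation_mono_finite supp)
      fix h assume h: "h \<in> set_pmf P"
      have "c * \<Delta> * real (length (filter (\<lambda>p. fst p \<noteq> a) h)) \<le> regret k Ob \<rho> h"
        unfolding \<rho>_\<sigma>_def using obs carA ab \<Delta>0 gapA c supp(3)[of h] h by (intro regret_mixed_state_ge) auto
      then show "c * \<Delta> * real T * u h \<le> regret k Ob \<rho> h"
        using supp(3)[of h] h False by (simp add: u_def)
    qed
    then have regA: "c * \<Delta> * real T * measure_pmf.expectation P u \<le> expected_regret d k Ob \<rho> \<pi> T"
      by (simp only: integral_mult_right_zero)
    have "measure_pmf.expectation Q (\<lambda>h. c * \<Delta> * real T * (1 - u h)) \<le> expected_regret d k Ob \<sigma> \<pi> T"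
      unfolding expected_regret_def P_Q_def[symmetric]
    proof (intro expectation_mono_finite supp)
      fix h assume h: "h \<in> set_pmf Q"
      have len: "length h = T" using supp(3)[of h] h by simp
      \<comment> \<open>Pulls of \<open>a\<close> are pulls of an arm other than \<open>b\<close>,
        so under \<sigma> the rounds counted by \<open>1 - u h\<close> all incur loss.\<close>
      have "length (filter (\<lambda>p. fst p = a) h) \<le> length (filter (\<lambda>p. fst p \<noteq> b) h)"
        using ab by (induction h) auto
      then have "c * \<Delta> * real (length (filter (\<lambda>p. fst p = a) h))
          \<le> c * \<Delta> * real (length (filter (\<lambda>p. fst p \<noteq> b) h))"
        using c \<Delta>0 by (intro mult_left_mono) auto
      also have "\<dots> \<le> regret k Ob \<sigma> h"
        unfolding \<rho>_\<sigma>_def using obs carB ab \<Delta>0 gapB c supp(3)[of h] h by (intro regret_mixed_state_ge) auto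
      also have "real (length (filter (\<lambda>p. fst p = a) h)) = real T - real (length (filter (\<lambda>p. fst p \<noteq> a) h))"
        using sum_length_filter_compl[of "\<lambda>p. fst p = a" h] len by linarith
      also have "\<dots> = real T * (1 - u h)"
        using len False by (simp add: u_def right_diff_distrib)
      finally show "c * \<Delta> * real T * (1 - u h) \<le> regret k Ob \<sigma> h" by simp
    qed
    then have regB: "c * \<Delta> * real T * measure_pmf.expectation Q (\<lambda>h. 1 - u h) \<le> expected_regret d k Ob \<sigma> \<pi> T"
      by (simp only: integral_mult_right_zero)
    \<comment> \<open>The two expected regrets add up to at least
      \<open>c * \<Delta> * T / 4\<close>, which is \<open>c * sqrt T / (8 * d)\<close>; the larger
      one is at least half of this, whence the 16.\<close>
    have "c * \<Delta> * real T * (1/4) \<le> c * \<Delta> * real T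
        * (measure_pmf.expectation P u + measure_pmf.expectation Q (\<lambda>h. 1 - u h))"
      using test c \<Delta>0 by (intro mult_left_mono) auto
    also have "\<dots> \<le> expected_regret d k Ob \<rho> \<pi> T + expected_regret d k Ob \<sigma> \<pi> T"
      using regA regB by (simp only: distrib_left)
    also have "c * \<Delta> * real T * (1/4) = 2 * (c / (16 * real d) * sqrt (real T))"
    proof -
      have "c * \<Delta> * real T * (1/4) = c / (8 * real d) * (real T / sqrt (real T))"
        by (simp add: \<Delta>_def)
      also have "real T / sqrt (real T) = sqrt (real T)" by (rule real_div_sqrt) simp
      finally show ?thesis by simp
    qed
    finally have "c / (16 * real d) * sqrt (real T) \<le> expected_regret d k Ob \<rho> \<pi> T
        \<or> c / (16 * real d) * sqrt (real T) \<le> expected_regret d k Ob \<sigma> \<pi> T" by linarith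
    then show ?thesis using den by blast
  qed
  then show ?thesis using c d by (intro exI[of _ "c / (16 * real d)"]) auto
qed

end
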